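(* Let $m,n\ge1$, let $\mathbb{X}$ be an $m$-dimensional strictly convex real Banach space and let $\mathbb{Y}$ be an $n$-dimensional smooth real Banach space. Then $S_{\mathbb{L}(\mathbb{X},\mathbb{Y})}$ has a ball covering consisting of $mn+1$ balls.
   Context: $\mathbb{L}(\mathbb{X},\mathbb{Y})$ is the space of (bounded) linear operators from $\mathbb{X}$ to $\mathbb{Y}$ with the operator norm and $S_{\mathbb{Z}}$ denotes the unit sphere of $\mathbb{Z}$. A Banach space is smooth if every $x$ in its unit sphere has exactly one supporting functional, i.e. exactly one norm-one functional $x^*$ with $x^*(x)=\|x\|$. A subset $\mathcal{A}$ of a normed space $\mathbb{Z}$ has a ball covering consisting of $k$ balls if there are $z_1,\dots,z_k\in\mathbb{Z}\setminus\{0\}$ and $0<r_i\le\|z_i\|$ with $\mathcal{A}\subseteq\bigcup_{i=1}^k B(z_i,r_i)$, where $B(z,r)$ is the open ball of center $z$ and radius $r$. *)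

theory Defs
  imports "HOL-Analysis.Analysis"
begin

definition strictly_convex_space :: "'a::real_normed_vector itself \<Rightarrow> bool" where
  "strictly_convex_space _ \<longleftrightarrow>
     (\<forall>x\<in>sphere (0::'a) 1. \<forall>y\<in>sphere 0 1. \<forall>t\<in>{0<..<1}.
        x \<noteq> y \<longrightarrow> norm ((1 - t) *\<^sub>R x + t *\<^sub>R y) < 1)"

definition smooth_space :: "'a::real_normed_vector itself \<Rightarrow> bool" where
  "smooth_space _ \<longleftrightarrow>
     (\<forall>x\<in>sphere (0::'a) 1.
        \<exists>!f::'a \<Rightarrow>\<^sub>L real. norm f = 1 \<and> blinfun_apply f x = norm x)"

definition has_ball_covering :: "'a::real_normed_vector set \<Rightarrow> nat \<Rightarrow> bool" where
  "has_ball_covering A k \<longleftrightarrow>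
     (\<exists>(z::nat \<Rightarrow> 'a) (r::nat \<Rightarrow> real).
        (\<forall>i<k. z i \<noteq> 0 \<and> 0 < r i \<and> r i \<le> norm (z i)) \<and>
        A \<subseteq> (\<Union>i<k. ball (z i) (r i)))"

end

theory Submission
  imports Defs
begin

text \<open>
  Enlarging a ball \<open>B(\<lambda>z, \<lambda>)\<close> with \<open>\<parallel>z\<parallel> = 1\<close> by letting \<open>\<lambda>\<close> grow, one sweeps out an increasing union
  of open sets.  If \<open>z\<close> is a smooth point of the unit sphere, with supporting functional \<open>F\<close>, this
  union contains the open half-space \<open>{F > 0}\<close>: the norm has derivative \<open>-F(T)\<close> at \<open>z\<close> in the
  direction \<open>-T\<close>.  Since the unit sphere of a finite-dimensional space is compact, it is covered by
  \<open>k\<close> balls as soon as there are \<open>k\<close> such functionals of which at least one is positive at each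
  nonzero vector.

  In \<open>L(X,Y)\<close> every functional \<open>T \<mapsto> f(Tx)\<close> with \<open>x \<noteq> 0\<close> and \<open>f \<noteq> 0\<close> comes, up to a positive factor,
  from a smooth point, namely from the operator \<open>u \<mapsto> \<phi>(u) y\<close>, where \<open>\<phi>\<close> is a norm-one functional
  norming \<open>x\<close> and \<open>y\<close> is a unit vector at which \<open>f\<close> attains its norm.  Indeed, strict
  convexity of \<open>X\<close> makes \<open>\<plusminus>x/\<parallel>x\<parallel>\<close> the only unit vectors where this operator attains its norm, and
  smoothness of \<open>Y\<close> makes \<open>f/\<parallel>f\<parallel>\<close> the only functional norming \<open>y\<close>.  This is
  \<open>rank_one_direction\<close>.

  It remains to find \<open>mn + 1\<close> such functionals.  Take bases \<open>b\<^sub>1,\<dots>,b\<^sub>m\<close> of \<open>X\<close> and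
  \<open>f\<^sub>1,\<dots>,f\<^sub>n\<close> of the dual of \<open>Y\<close>, the \<open>mn\<close> functionals \<open>T \<mapsto> f\<^sub>k(T b\<^sub>j)\<close>, and, as the last one, minus their sum.
  The last one has the required form because it is \<open>T \<mapsto> f(Tx)\<close> for \<open>x = -(b\<^sub>1 + \<dots> + b\<^sub>m)\<close> and
  \<open>f = f\<^sub>1 + \<dots> + f\<^sub>n\<close>.  If none of them is positive at \<open>T\<close>, then all of them vanish there, so
  \<open>T = 0\<close>.
\<close>

section \<open>Finite-dimensional normed spaces\<close>

locale finite_basis =
  fixes B :: "'a::real_normed_vector set"
  assumes finite_B: "finite B" and indep_B: "independent B" and span_B: "span B = UNIV"
begin

lemma sum_representation: "(\<Sum>b\<in>B. representation B x b *\<^sub>R b) = x"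
  using sum_representation_eq[of B x B] finite_B indep_B span_B by simp

lemma linear_representation_coordinate: "linear (\<lambda>x. representation B x b)"
  using real_vector.linear_representation[OF indep_B span_B]
  by (simp add: real_scaleR_def[abs_def] linear_def)

text \<open>
  The coefficient vectors whose largest entry has absolute value \<open>1\<close> form a compact set.  By
  independence, the set of their linear combinations misses \<open>0\<close>, and being compact it
  stays at some distance \<open>d\<close> from it; the reciprocal of \<open>d\<close> bounds the coordinates.
\<close>

lemma coordinates_bounded:
  obtains c where "c > 0" "\<And>x b. \<bar>representation B x b\<bar> \<le> c * norm x"
proof -
  define g where "g h = (\<Sum>b\<in>B. h b *\<^sub>R b)" for h :: "'a \<Rightarrow> real"
  have cont_g: "continuous_on S g" for S
    unfolding g_def
    by (intro continuous_intros continuous_on_subset[OF continuous_on_product_coordinates]) auto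
  define K where "K b = PiE UNIV (\<lambda>a. if a = b then {-1, 1} else if a \<in> B then {-1..1} else {0::real})" for b
  have "compact (K b)" for b
    unfolding K_def
    using compactin_PiE[of "\<lambda>_::'a. euclidean :: real topology" UNIV]
    by (auto simp: euclidean_product_topology)
  then have "compact (\<Union>b\<in>B. g ` K b)"
    using finite_B by (intro compact_UN compact_continuous_image cont_g)
  moreover have "0 \<notin> (\<Union>b\<in>B. g ` K b)"
  proof
    assume "0 \<in> (\<Union>b\<in>B. g ` K b)"
    then obtain b h where b: "b \<in> B" "h \<in> K b" "(\<Sum>b\<in>B. h b *\<^sub>R b) = 0"
      by (auto simp: g_def)
    then have "h b = 0"
      using indep_B finite_B by (auto simp: dependent_finite)
    then show False
      using b(2) unfolding K_def by (auto simp: PiE_def Pi_def split: if_splits)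
  qed
  ultimately obtain d where "d > 0" "ball 0 d \<subseteq> - (\<Union>b\<in>B. g ` K b)"
    by (meson ComplI compact_imp_closed open_Compl open_contains_ball)
  then have d: "d > 0" "\<And>y. y \<in> (\<Union>b\<in>B. g ` K b) \<Longrightarrow> d \<le> dist 0 y"
    by (auto simp: subset_iff not_less[symmetric] simp del: UN_iff)
  have "\<bar>representation B x b\<bar> \<le> (1 / d) * norm x" for x b
  proof (cases "representation B x b = 0")
    case False
    let ?r = "representation B x"
    have "b \<in> B"
      using False by (rule representation_ne_zero)
    define M where "M = Max ((\<lambda>b. \<bar>?r b\<bar>) ` B)"
    have le_M: "\<bar>?r a\<bar> \<le> M" if "a \<in> B" for a
      unfolding M_def using that finite_B by simp
    have "M > 0"
      using le_M[OF \<open>b \<in> B\<close>] False by linarith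
    have "M \<in> (\<lambda>b. \<bar>?r b\<bar>) ` B"
      unfolding M_def using finite_B \<open>b \<in> B\<close> by (intro Max_in) auto
    then obtain b0 where b0: "b0 \<in> B" "\<bar>?r b0\<bar> = M"
      by auto
    have "?r a = 0" if "a \<notin> B" for a
      using representation_ne_zero[of B x a] that by blast
    moreover have "-1 \<le> ?r a / M \<and> ?r a / M \<le> 1" if "a \<in> B" for a
      using le_M[OF that] \<open>M > 0\<close> by (simp add: abs_le_iff field_simps)
    moreover have "?r b0 / M = -1 \<or> ?r b0 / M = 1"
      using b0(2) \<open>M > 0\<close> by (auto simp: abs_if split: if_splits)
    ultimately have "(\<lambda>a. ?r a / M) \<in> K b0"
      unfolding K_def by auto
    moreover have "g (\<lambda>a. ?r a / M) = (1 / M) *\<^sub>R x"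
      unfolding g_def by (subst (2) sum_representation[symmetric, of x]) (simp add: scaleR_sum_right)
    ultimately have "d \<le> dist 0 ((1 / M) *\<^sub>R x)"
      using d(2) b0(1) by (metis UN_I imageI)
    then have "d * M \<le> norm x"
      using \<open>M > 0\<close> by (simp add: field_simps)
    then have "d * \<bar>?r b\<bar> \<le> norm x"
      using le_M[OF \<open>b \<in> B\<close>] d(1) by (meson less_imp_le mult_left_mono order_trans)
    then show ?thesis
      using d(1) by (simp add: field_simps)
  qed (use d(1) in simp)
  with that[of "1 / d"] d(1) show ?thesis
    by simp
qed

lemma bounded_linear_of_linear:
  fixes f :: "'a \<Rightarrow> 'c::real_normed_vector"
  assumes "linear f"
  shows "bounded_linear f"
proof -
  interpret f: linear f by fact
  obtain c where c: "c > 0" "\<And>x b. \<bar>representation B x b\<bar> \<le> c * norm x"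
    using coordinates_bounded by blast
  have "norm (f x) \<le> norm x * (\<Sum>b\<in>B. c * norm (f b))" for x
  proof -
    have "f x = (\<Sum>b\<in>B. representation B x b *\<^sub>R f b)"
      by (subst sum_representation[symmetric, of x]) (simp add: f.sum f.scaleR)
    then have "norm (f x) \<le> (\<Sum>b\<in>B. norm (representation B x b *\<^sub>R f b))"
      by (metis norm_sum)
    also have "\<dots> \<le> (\<Sum>b\<in>B. (c * norm x) * norm (f b))"
      by (intro sum_mono) (simp add: c(2) mult_right_mono)
    finally show ?thesis
      by (simp add: sum_distrib_left mult_ac)
  qed
  then show ?thesis
    by unfold_locales auto
qed

lemma compact_cball: "compact (cball (0::'a) r)"
proof -
  obtain c where c: "c > 0" "\<And>x b. \<bar>representation B x b\<bar> \<le> c * norm x"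
    using coordinates_bounded by blast
  define K where "K = PiE UNIV (\<lambda>_::'a. {- (c * r)..c * r})"
  have "compact K"
    unfolding K_def
    using compactin_PiE[of "\<lambda>_::'a. euclidean :: real topology" UNIV]
    by (auto simp: euclidean_product_topology)
  moreover have "continuous_on K (\<lambda>h. \<Sum>b\<in>B. h b *\<^sub>R b)"
    by (intro continuous_intros continuous_on_subset[OF continuous_on_product_coordinates]) auto
  ultimately have "compact ((\<lambda>h. \<Sum>b\<in>B. h b *\<^sub>R b) ` K)"
    by (rule compact_continuous_image[rotated])
  moreover have "cball 0 r \<subseteq> (\<lambda>h. \<Sum>b\<in>B. h b *\<^sub>R b) ` K"
  proof
    fix x :: 'a
    assume "x \<in> cball 0 r"
    then have "c * norm x \<le> c * r"
      using c(1) by simp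
    then have "\<bar>representation B x b\<bar> \<le> c * r" for b
      using c(2)[of x b] by linarith
    then have "representation B x \<in> K"
      by (auto simp: K_def abs_le_iff minus_le_iff)
    then show "x \<in> (\<lambda>h. \<Sum>b\<in>B. h b *\<^sub>R b) ` K"
      using sum_representation[of x] by force
  qed
  ultimately have "compact ((\<lambda>h. \<Sum>b\<in>B. h b *\<^sub>R b) ` K \<inter> cball 0 r)" "(\<lambda>h. \<Sum>b\<in>B. h b *\<^sub>R b) ` K \<inter> cball 0 r = cball 0 r"
    by (auto intro: compact_Int_closed)
  then show ?thesis
    by simp
qed

lemma compact_sphere: "compact (sphere (0::'a) r)"
proof -
  have "compact (cball (0::'a) r \<inter> sphere 0 r)"
    unfolding sphere_def
    by (intro compact_Int_closed compact_cball closed_Collect_eq continuous_intros)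
  moreover have "cball (0::'a) r \<inter> sphere 0 r = sphere 0 r"
    by auto
  ultimately show ?thesis
    by simp
qed

lemma norm_attained:
  fixes f :: "'a \<Rightarrow>\<^sub>L 'c::real_normed_vector"
  assumes "f \<noteq> 0"
  obtains u where "norm u = 1" "norm (f u) = norm f"
proof -
  obtain v where "f v \<noteq> 0"
    using assms by (metis blinfun_eqI zero_blinfun.rep_eq)
  then have "v \<noteq> 0"
    using blinfun.zero_right by metis
  then have "sgn v \<in> sphere 0 1"
    by (simp add: norm_sgn)
  then have "sphere (0::'a) 1 \<noteq> {}"
    by blast
  then have "\<exists>u\<in>sphere 0 1. \<forall>w\<in>sphere 0 1. norm (f w) \<le> norm (f u)"
    by (intro continuous_attains_sup compact_sphere continuous_intros)
  then obtain u where u: "norm u = 1" "\<And>w. norm w = 1 \<Longrightarrow> norm (f w) \<le> norm (f u)"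
    by auto
  have "norm (f w) \<le> norm (f u) * norm w" for w
  proof (cases "w = 0")
    case False
    then have "norm (f (sgn w)) \<le> norm (f u)"
      by (intro u(2)) (simp add: norm_sgn)
    then show ?thesis
      using False by (simp add: sgn_div_norm blinfun.scaleR_right field_simps)
  qed (simp add: blinfun.zero_right)
  then have "norm f \<le> norm (f u)"
    by (intro norm_blinfun_bound) auto
  moreover have "norm (f u) \<le> norm f"
    using norm_blinfun[of f u] u(1) by simp
  ultimately show ?thesis
    using that u(1) by simp
qed

definition coord :: "'a \<Rightarrow> 'a \<Rightarrow>\<^sub>L real" where
  "coord b = Blinfun (\<lambda>x. representation B x b)"

lemma coord_apply: "coord b x = representation B x b"
  unfolding coord_def
  by (simp add: bounded_linear_Blinfun_apply bounded_linear_of_linear linear_representation_coordinate)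

lemma sum_coord: "(\<Sum>b\<in>B. coord b x *\<^sub>R b) = x"
  by (simp add: coord_apply sum_representation)

lemma coord_basis: "a \<in> B \<Longrightarrow> coord b a = (if b = a then 1 else 0)"
  using indep_B by (simp add: coord_apply representation_basis)

end

lemma finite_basis_of_spanning_set:
  fixes S :: "'a::real_normed_vector set"
  assumes "finite S" "span S = UNIV"
  shows "\<exists>B::'a set. finite_basis B"
proof -
  obtain B where B: "B \<subseteq> S" "independent B" "S \<subseteq> span B"
    using maximal_independent_subset by blast
  have "span B = UNIV"
    using span_minimal[OF B(3) subspace_span] assms(2) by auto
  with B assms(1) finite_subset have "finite_basis B"
    by unfold_locales auto
  then show ?thesis ..
qed

text \<open>The operators \<open>u \<mapsto> b\<^sup>*(u) c\<close>, for \<open>b\<close> and \<open>c\<close> in the two bases, span.\<close>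

lemma finite_basis_blinfun:
  fixes B :: "'a::real_normed_vector set" and C :: "'b::real_normed_vector set"
  assumes "finite_basis B" "finite_basis C"
  shows "\<exists>D::('a \<Rightarrow>\<^sub>L 'b) set. finite_basis D"
proof -
  interpret B: finite_basis B by fact
  interpret C: finite_basis C by fact
  define E where "E = (\<lambda>(b, c). blinfun_scaleR_left c o\<^sub>L B.coord b) ` (B \<times> C)"
  have "T \<in> span E" for T
  proof -
    have "T = (\<Sum>b\<in>B. \<Sum>c\<in>C. C.coord c (T b) *\<^sub>R (blinfun_scaleR_left c o\<^sub>L B.coord b))"
    proof (rule blinfun_eqI)
      fix x
      have "T x = (\<Sum>b\<in>B. B.coord b x *\<^sub>R T b)"
        by (subst B.sum_coord[symmetric, of x]) (simp only: blinfun.sum_right blinfun.scaleR_right)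
      also have "\<dots> = (\<Sum>b\<in>B. B.coord b x *\<^sub>R (\<Sum>c\<in>C. C.coord c (T b) *\<^sub>R c))"
        by (simp only: C.sum_coord)
      finally show "T x = (\<Sum>b\<in>B. \<Sum>c\<in>C. C.coord c (T b) *\<^sub>R (blinfun_scaleR_left c o\<^sub>L B.coord b)) x"
        by (simp add: blinfun.sum_left blinfun.scaleR_left scaleR_sum_right mult.commute)
    qed
    also have "\<dots> \<in> span E"
      by (intro span_sum span_scale span_base) (auto simp: E_def)
    finally show ?thesis .
  qed
  moreover have "finite E"
    using B.finite_B C.finite_B by (simp add: E_def)
  ultimately show ?thesis
    using finite_basis_of_spanning_set[of E] by blast
qed

lemma finite_basis_real: "finite_basis {1::real}"
proof
  show "span {1::real} = UNIV"
    by (auto simp: span_singleton)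
qed auto

text \<open>An infinite-dimensional space has \<open>dim\<close> equal to \<open>0\<close>, the cardinality assigned to an infinite basis.\<close>

lemma dim_pos_finite_basis:
  assumes "dim (UNIV :: 'a set) \<ge> 1"
  obtains B :: "'a::real_normed_vector set" where "finite_basis B" "card B = dim (UNIV :: 'a set)"
proof -
  obtain B :: "'a set" where B: "independent B" "UNIV \<subseteq> span B" "card B = dim (UNIV :: 'a set)"
    using basis_exists by blast
  moreover have "finite B"
    using B(3) assms by (intro card_ge_0_finite) auto
  ultimately show ?thesis
    using that[of B] by (auto simp: finite_basis_def)
qed

text \<open>
  The one-dimensional step of the Hahn--Banach theorem: a value \<open>a\<close> at \<open>b\<close> is admissible if and only
  if it lies between all \<open>f u - \<parallel>u - b\<parallel>\<close> and all \<open>\<parallel>w + b\<parallel> - f w\<close>, with \<open>u\<close> and \<open>w\<close> in the span.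
  Such an \<open>a\<close> exists because \<open>f(u + w) \<le> \<parallel>u + w\<parallel> \<le> \<parallel>u - b\<parallel> + \<parallel>w + b\<parallel>\<close>.
\<close>

lemma dominated_extension_step:
  fixes f :: "'a::real_normed_vector \<Rightarrow> real"
  assumes "linear f" "\<And>v. v \<in> span S \<Longrightarrow> f v \<le> norm v"
  obtains g where "linear g" "\<And>v. v \<in> span S \<Longrightarrow> g v = f v"
    "\<And>v. v \<in> span (insert b S) \<Longrightarrow> g v \<le> norm v"
proof (cases "b \<in> span S")
  case True
  then show ?thesis
    using that[of f] assms by (simp add: span_redundant)
next
  case False
  interpret f: linear f by fact
  obtain C where C: "C \<subseteq> S" "independent C" "S \<subseteq> span C"
    using maximal_independent_subset by blast
  have span_C: "span C = span S"
    by (intro antisym span_mono C(1) span_minimal[OF C(3) subspace_span])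
  then have "independent (insert b C)"
    using False C(2) by (intro independent_insertI) auto
  \<comment> \<open>Adding a multiple of \<open>p\<close> to \<open>f\<close> changes the value at \<open>b\<close> but none on the span of \<open>S\<close>.\<close>
  then obtain p :: "'a \<Rightarrow> real" where p: "linear p" "\<forall>x\<in>insert b C. p x = (if x = b then 1 else 0)"
    using linear_independent_extend[of "insert b C" "\<lambda>x. if x = b then 1 else 0"] by blast
  interpret p: linear p by fact
  have "b \<notin> C"
    using False span_C span_base by blast
  then have "p x = 0" if "x \<in> C" for x
    using p(2) that by auto
  then have p0: "p v = 0" if "v \<in> span S" for v
    using linear_eq_0_on_span[OF p(1), of C v] \<open>\<And>x. x \<in> C \<Longrightarrow> p x = 0\<close> that span_C by auto
  define a where "a = (SUP u\<in>span S. f u - norm (u - b))"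
  have key: "f u - norm (u - b) \<le> norm (w + b) - f w" if "u \<in> span S" "w \<in> span S" for u w
  proof -
    have "f u + f w \<le> norm (u + w)"
      using assms(2)[of "u + w"] that by (simp add: f.add span_add)
    also have "\<dots> \<le> norm (u - b) + norm (w + b)"
      using norm_triangle_ineq[of "u - b" "w + b"] by simp
    finally show ?thesis by simp
  qed
  have bdd: "bdd_above ((\<lambda>u. f u - norm (u - b)) ` span S)"
    using key[OF _ span_zero] by (intro bdd_aboveI2) auto
  have lower: "f u - norm (u - b) \<le> a" if "u \<in> span S" for u
    unfolding a_def using bdd that by (rule cSUP_upper2[OF _ _ order_refl])
  have upper: "a \<le> norm (w + b) - f w" if "w \<in> span S" for w
    unfolding a_def using key that span_zero by (intro cSUP_least) auto
  define g where "g v = f v + (a - f b) * p v" for v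
  show ?thesis
  proof
    show "linear g"
      by (rule linearI) (simp_all add: g_def f.add p.add f.scaleR p.scaleR algebra_simps)
    show "g v = f v" if "v \<in> span S" for v
      using that by (simp add: g_def p0)
    show "g v \<le> norm v" if v: "v \<in> span (insert b S)" for v
    proof -
      obtain t where t: "v - t *\<^sub>R b \<in> span S"
        using v by (auto simp: span_insert)
      define s where "s = v - t *\<^sub>R b"
      have v_eq: "v = s + t *\<^sub>R b" and s: "s \<in> span S"
        using t by (auto simp: s_def)
      have "p b = 1"
        using p(2) by simp
      then have g_v: "g v = f s + t * a"
        using p0[OF s] by (simp add: v_eq g_def f.add f.scaleR p.add p.scaleR algebra_simps)
      consider "t = 0" | "t > 0" | "t < 0" by linarith
      then show ?thesis
      proof cases
        case 1
        then show ?thesis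
          using g_v v_eq assms(2)[OF s] by simp
      next
        case 2
        have "t * a \<le> t * (norm ((1/t) *\<^sub>R s + b) - f ((1/t) *\<^sub>R s))"
          using 2 s by (intro mult_left_mono upper span_scale) auto
        moreover have "t * norm ((1/t) *\<^sub>R s + b) = norm (t *\<^sub>R ((1/t) *\<^sub>R s + b))"
          using 2 by simp
        moreover have "t *\<^sub>R ((1/t) *\<^sub>R s + b) = v"
          using 2 by (simp add: v_eq scaleR_add_right)
        ultimately show ?thesis
          using 2 g_v by (simp add: f.scaleR right_diff_distrib)
      next
        case 3
        define q where "q = - t"
        have q: "q > 0" "t = - q"
          using 3 by (auto simp: q_def)
        have "q * (f ((1/q) *\<^sub>R s) - norm ((1/q) *\<^sub>R s - b)) \<le> q * a"
          using q s by (intro mult_left_mono lower span_scale) auto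
        moreover have "q * norm ((1/q) *\<^sub>R s - b) = norm (q *\<^sub>R ((1/q) *\<^sub>R s - b))"
          using q by simp
        moreover have "q *\<^sub>R ((1/q) *\<^sub>R s - b) = v"
          using q by (simp add: v_eq scaleR_diff_right)
        ultimately show ?thesis
          using q g_v by (simp add: f.scaleR right_diff_distrib)
      qed
    qed
  qed
qed

text \<open>
  Starting from the line through \<open>x\<close>, where a norming functional is evident, the finitely many basis
  vectors are adjoined one at a time.
\<close>

lemma (in finite_basis) norming_functional:
  obtains f :: "'a \<Rightarrow>\<^sub>L real" where "norm f \<le> 1" "f x = norm x"
proof -
  have "\<exists>f::'a \<Rightarrow> real. linear f \<and> f x = norm x \<and> (\<forall>v\<in>span (S \<union> {x}). f v \<le> norm v)"
    if "finite S" for S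
    using that
  proof induction
    case empty
    obtain f :: "'a \<Rightarrow> real" where f: "linear f" "f x = norm x"
    proof (cases "x = 0")
      case True
      show ?thesis
        by (rule that[of "\<lambda>_. 0"]) (use True in \<open>auto intro: linearI\<close>)
    next
      case False
      then have "independent {x}" by simp
      then show ?thesis
        using that linear_independent_extend[of "{x}" "\<lambda>_. norm x"] by auto
    qed
    have "f v \<le> norm v" if v: "v \<in> span {x}" for v
    proof -
      obtain k where "v = k *\<^sub>R x"
        using v by (auto simp: span_singleton)
      then show ?thesis
        using f by (simp add: linear_scale mult_right_mono)
    qed
    then show ?case
      using f by auto
  next
    case (insert b S)
    then obtain f :: "'a \<Rightarrow> real" where
      f: "linear f" "f x = norm x" "\<And>v. v \<in> span (S \<union> {x}) \<Longrightarrow> f v \<le> norm v"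
      by blast
    obtain g where g: "linear g" "\<And>v. v \<in> span (S \<union> {x}) \<Longrightarrow> g v = f v"
      "\<And>v. v \<in> span (insert b (S \<union> {x})) \<Longrightarrow> g v \<le> norm v"
      using dominated_extension_step[OF f(1,3)] by blast
    have "g x = norm x"
      using g(2)[of x] f(2) by (simp add: span_base)
    then show ?case
      using g(1,3) by (metis Un_insert_left)
  qed
  then obtain f :: "'a \<Rightarrow> real" where
    f: "linear f" "f x = norm x" "\<And>v. v \<in> span (B \<union> {x}) \<Longrightarrow> f v \<le> norm v"
    using finite_B by blast
  have "span (B \<union> {x}) = UNIV"
    using span_B span_mono[of B "B \<union> {x}"] by auto
  then have "f v \<le> norm v" for v
    using f(3) by blast
  from this this[of "- v" for v] have "\<bar>f v\<bar> \<le> norm v" for v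
    using linear_neg[OF f(1)] by (simp add: abs_le_iff)
  moreover have app: "blinfun_apply (Blinfun f) = f"
    using f(1) by (intro bounded_linear_Blinfun_apply bounded_linear_of_linear)
  ultimately have "norm (Blinfun f) \<le> 1"
    by (intro norm_blinfun_bound) auto
  then show ?thesis
    using that[of "Blinfun f"] f(2) by (simp add: app)
qed

section \<open>Rank-one operators as smooth points\<close>

lemma abs_blinfun_apply_le_1:
  fixes f :: "'a::real_normed_vector \<Rightarrow>\<^sub>L real"
  assumes "norm f \<le> 1" "norm x \<le> 1"
  shows "\<bar>f x\<bar> \<le> 1"
  using norm_blinfun[of f x] mult_le_one[of "norm f" "norm x"] assms by simp

lemma strictly_convex_functional_eq:
  fixes f :: "'a::real_normed_vector \<Rightarrow>\<^sub>L real"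
  assumes "strictly_convex_space TYPE('a)" "norm f \<le> 1"
    "norm u = 1" "f u = 1" "norm v = 1" "f v = 1"
  shows "u = v"
proof (rule ccontr)
  assume "u \<noteq> v"
  then have "norm ((1 - 1/2) *\<^sub>R u + (1/2) *\<^sub>R v) < 1"
    using assms unfolding strictly_convex_space_def
    by (metis (no_types, opaque_lifting) dist_0_norm mem_sphere greaterThanLessThan_iff
        half_gt_zero_iff zero_less_one one_less_numeral_iff divide_less_eq_1_pos semiring_norm(76) zero_less_numeral)
  moreover have "f ((1 - 1/2) *\<^sub>R u + (1/2) *\<^sub>R v) = 1"
    using assms by (simp add: blinfun.add_right blinfun.scaleR_right)
  ultimately show False
    using norm_blinfun[of f "(1 - 1/2) *\<^sub>R u + (1/2) *\<^sub>R v"] assms(2)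
      mult_right_mono[OF assms(2) norm_ge_zero, of "(1 - 1/2) *\<^sub>R u + (1/2) *\<^sub>R v"] by simp
qed

text \<open>
  If the conclusion fails for \<open>T\<close>, then for every \<open>N\<close> there are a unit vector \<open>u\<close> and a functional
  \<open>g\<close> of norm at most one with \<open>g(N \<phi>(u) y - T u) \<ge> N\<close>.  Dividing by \<open>N\<close> shows that \<open>\<phi>(u) g(y)\<close>
  tends to \<open>1\<close>, and \<open>\<phi>(u) g(y) \<le> 1\<close> shows that \<open>g(T u) \<le> 0\<close>.  By strict convexity and smoothness,
  a limit point of the pairs \<open>(u, g)\<close> can only be \<open>(x/\<parallel>x\<parallel>, f/\<parallel>f\<parallel>)\<close> up to a common sign.
\<close>

lemma rank_one_direction:
  fixes B :: "'a::real_normed_vector set" and C :: "'b::real_normed_vector set"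
    and f :: "'b \<Rightarrow>\<^sub>L real"
  assumes "finite_basis B" "finite_basis C"
    and convex: "strictly_convex_space TYPE('a)" and smooth: "smooth_space TYPE('b)"
    and "x \<noteq> 0" "f \<noteq> 0"
  shows "\<exists>z::'a \<Rightarrow>\<^sub>L 'b. norm z = 1 \<and>
    (\<forall>T. f (blinfun_apply T x) > 0 \<longrightarrow> (\<exists>t>0. norm (t *\<^sub>R z - T) < t))"
proof -
  interpret B: finite_basis B by fact
  interpret C: finite_basis C by fact
  obtain D :: "('b \<Rightarrow>\<^sub>L real) set" where "finite_basis D"
    using finite_basis_blinfun[OF assms(2) finite_basis_real] by blast
  then interpret D: finite_basis D .
  define x0 where "x0 = sgn x"
  have x0: "norm x0 = 1" "x = norm x *\<^sub>R x0"
    using \<open>x \<noteq> 0\<close> by (auto simp: x0_def norm_sgn sgn_div_norm)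
  obtain \<phi> :: "'a \<Rightarrow>\<^sub>L real" where \<phi>: "norm \<phi> \<le> 1" "\<phi> x0 = 1"
    using B.norming_functional[of x0] x0(1) by metis
  obtain y' where y': "norm y' = 1" "norm (f y') = norm f"
    using C.norm_attained[OF \<open>f \<noteq> 0\<close>] by blast
  define y where "y = sgn (f y') *\<^sub>R y'"
  have "f y' \<noteq> 0"
    using y'(2) \<open>f \<noteq> 0\<close> by auto
  then have y: "norm y = 1" "f y = norm f"
    using y' by (auto simp: y_def blinfun.scaleR_right sgn_if)
  define z where "z = blinfun_scaleR_left y o\<^sub>L \<phi>"
  have z_apply: "z u = \<phi> u *\<^sub>R y" for u
    by (simp add: z_def)
  have "\<bar>\<phi> u\<bar> \<le> norm u" for u
    using norm_blinfun[of \<phi> u] mult_right_mono[OF \<phi>(1) norm_ge_zero[of u]] by simp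
  then have "norm z \<le> 1"
    using y(1) by (intro norm_blinfun_bound) (simp_all add: z_apply)
  moreover have "1 \<le> norm z"
    using norm_blinfun[of z x0] x0(1) \<phi>(2) y(1) by (simp add: z_apply)
  ultimately have "norm z = 1"
    by simp
  moreover have "\<exists>t>0. norm (t *\<^sub>R z - T) < t" if "f (T x) > 0" for T :: "'a \<Rightarrow>\<^sub>L 'b"
  proof (rule ccontr)
    assume "\<not> (\<exists>t>0. norm (t *\<^sub>R z - T) < t)"
    then have large: "t \<le> norm (t *\<^sub>R z - T)" if "t > 0" for t
      using that by (meson not_le)
    have "\<exists>u g. norm u = 1 \<and> norm g \<le> 1 \<and>
        real (Suc n) \<le> blinfun_apply (g :: 'b \<Rightarrow>\<^sub>L real) ((real (Suc n) *\<^sub>R z - T) u)" for n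
    proof -
      have "real (Suc n) *\<^sub>R z - T \<noteq> 0"
        using large[of "real (Suc n)"] by auto
      then obtain u where u: "norm u = 1"
        "norm ((real (Suc n) *\<^sub>R z - T) u) = norm (real (Suc n) *\<^sub>R z - T)"
        using B.norm_attained by blast
      obtain g :: "'b \<Rightarrow>\<^sub>L real" where "norm g \<le> 1"
        "g ((real (Suc n) *\<^sub>R z - T) u) = norm ((real (Suc n) *\<^sub>R z - T) u)"
        using C.norming_functional by blast
      then show ?thesis
        using u large[of "real (Suc n)"] by (metis of_nat_0_less_iff zero_less_Suc)
    qed
    then obtain u g where u: "\<And>n. norm (u n) = 1" and g: "\<And>n. norm (g n) \<le> 1"
      and ug: "\<And>n. real (Suc n) \<le> blinfun_apply (g n :: 'b \<Rightarrow>\<^sub>L real) ((real (Suc n) *\<^sub>R z - T) (u n))"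
      by metis
    have ug': "real (Suc n) \<le> real (Suc n) * (\<phi> (u n) * g n y) - g n (T (u n))" for n
      using ug[of n]
      by (simp only: blinfun.diff_left blinfun.diff_right blinfun.scaleR_left blinfun.scaleR_right
          z_apply real_scaleR_def mult.assoc)
    have prod_le: "\<phi> (u n) * g n y \<le> 1" for n
    proof -
      have "\<bar>\<phi> (u n)\<bar> * \<bar>g n y\<bar> \<le> 1"
        using abs_blinfun_apply_le_1[OF \<phi>(1), of "u n"] abs_blinfun_apply_le_1[OF g[of n], of y] u y(1)
        by (intro mult_le_one) auto
      then show ?thesis
        by (metis abs_ge_self abs_mult order_trans)
    qed
    have gTu: "g n (T (u n)) \<le> 0" for n
      using order_trans[OF ug'[of n] diff_right_mono[OF mult_left_mono[OF prod_le[of n] of_nat_0_le_iff[of "Suc n"]]]]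
      by simp
    have gTu_ge: "- norm T \<le> g n (T (u n))" for n
    proof -
      have "\<bar>g n (T (u n))\<bar> \<le> norm (g n) * norm (T (u n))"
        using norm_blinfun[of "g n"] by simp
      also have "\<dots> \<le> 1 * norm (T (u n))"
        using g by (intro mult_right_mono) auto
      also have "norm (T (u n)) \<le> norm T"
        using norm_blinfun[of T "u n"] u by simp
      finally show ?thesis by simp
    qed
    have prod_ge: "1 - norm T / real (Suc n) \<le> \<phi> (u n) * g n y" for n
    proof -
      have "real (Suc n) - norm T \<le> real (Suc n) * (\<phi> (u n) * g n y)"
        using ug'[of n] gTu_ge[of n] by linarith
      then have "(real (Suc n) - norm T) / real (Suc n) \<le> \<phi> (u n) * g n y"
        by (simp only: pos_divide_le_eq of_nat_0_less_iff zero_less_Suc mult.commute)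
      then show ?thesis
        by (simp add: diff_divide_distrib del: of_nat_Suc)
    qed
    have "compact (sphere (0::'a) 1 \<times> cball (0::'b \<Rightarrow>\<^sub>L real) 1)"
      using compact_Times B.compact_sphere D.compact_cball by blast
    then have "seq_compact (sphere (0::'a) 1 \<times> cball (0::'b \<Rightarrow>\<^sub>L real) 1)"
      by (simp add: compact_eq_seq_compact_metric)
    moreover have "\<forall>n. (u n, g n) \<in> sphere 0 1 \<times> cball 0 1"
      using u g by simp
    ultimately obtain l r where l: "l \<in> sphere (0::'a) 1 \<times> cball (0::'b \<Rightarrow>\<^sub>L real) 1"
      "strict_mono r" "((\<lambda>n. (u n, g n)) \<circ> r) \<longlonglongrightarrow> l"
      by (rule seq_compactE)
    define v h where "v = fst l" and "h = snd l"
    have v: "norm v = 1" and h: "norm h \<le> 1"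
      using l(1) by (auto simp: v_def h_def)
    have lim_u: "(\<lambda>n. u (r n)) \<longlonglongrightarrow> v" and lim_g: "(\<lambda>n. g (r n)) \<longlonglongrightarrow> h"
      using tendsto_fst[OF l(3)] tendsto_snd[OF l(3)] by (simp_all add: v_def h_def o_def)
    have lim_prod: "(\<lambda>n. \<phi> (u (r n)) * g (r n) y) \<longlonglongrightarrow> \<phi> v * h y"
      by (intro tendsto_intros lim_u lim_g)
    have "(\<lambda>n. 1 - norm T / real (Suc (r n))) \<longlonglongrightarrow> 1 - 0"
    proof (intro tendsto_intros)
      have "(\<lambda>n. norm T / real (Suc n)) \<longlonglongrightarrow> 0"
        using LIMSEQ_Suc[OF lim_const_over_n[of "norm T"]] by simp
      then show "(\<lambda>n. norm T / real (Suc (r n))) \<longlonglongrightarrow> 0"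
        using LIMSEQ_subseq_LIMSEQ[OF _ l(2)] by (fastforce simp: o_def)
    qed
    then have prod1: "1 \<le> \<phi> v * h y"
      using LIMSEQ_le[OF _ lim_prod] prod_ge by auto
    have "(\<lambda>n. g (r n) (T (u (r n)))) \<longlonglongrightarrow> h (T v)"
      by (intro tendsto_intros lim_u lim_g)
    then have hTv: "h (T v) \<le> 0"
      using gTu by (intro LIMSEQ_le_const2) auto
    \<comment> \<open>Both factors of the product lie in \<open>[-1, 1]\<close>, so both are \<open>1\<close> or both are \<open>-1\<close>.\<close>
    obtain s where s: "s * s = 1" "\<bar>s\<bar> = 1" "\<phi> v = s" "h y = s"
    proof -
      have b: "\<bar>\<phi> v\<bar> \<le> 1" "\<bar>h y\<bar> \<le> 1"
        using abs_blinfun_apply_le_1 \<phi>(1) h v y(1) by (metis order_refl)+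
      have "(\<phi> v - h y)^2 = \<bar>\<phi> v\<bar>^2 + \<bar>h y\<bar>^2 - 2 * (\<phi> v * h y)"
        by (simp add: power2_eq_square algebra_simps)
      also have "\<dots> \<le> 0"
        using power_le_one[OF _ b(1), of 2] power_le_one[OF _ b(2), of 2] prod1 by simp
      finally have eq: "\<phi> v = h y"
        by simp
      have "1 \<le> \<bar>h y\<bar> * \<bar>h y\<bar>"
        using prod1 eq by simp
      moreover have "\<bar>h y\<bar> * \<bar>h y\<bar> \<le> \<bar>h y\<bar> * 1"
        using b(2) by (intro mult_left_mono) auto
      ultimately have "\<bar>h y\<bar> = 1"
        using b(2) by linarith
      moreover from this have "h y * h y = 1"
        by (metis abs_mult_self_eq mult_1)
      ultimately show ?thesis
        using that eq by blast
    qed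
    have sv: "s *\<^sub>R v = x0"
      using strictly_convex_functional_eq[OF convex \<phi>(1), of "s *\<^sub>R v" x0] s v x0(1) \<phi>(2)
      by (simp add: blinfun.scaleR_right)
    have sh: "s *\<^sub>R h = (1 / norm f) *\<^sub>R f"
    proof -
      have ex1: "\<exists>!f::'b \<Rightarrow>\<^sub>L real. norm f = 1 \<and> blinfun_apply f y = norm y"
        using smooth y(1) by (auto simp: smooth_space_def)
      have sh: "(s *\<^sub>R h) y = 1"
        using s by (simp add: blinfun.scaleR_left)
      have "1 \<le> norm (s *\<^sub>R h)"
        using norm_blinfun[of "s *\<^sub>R h" y] sh y(1) by simp
      then have "norm (s *\<^sub>R h) = 1"
        using h s(2) by simp
      moreover have "norm ((1 / norm f) *\<^sub>R f) = 1" "((1 / norm f) *\<^sub>R f) y = 1"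
        using \<open>f \<noteq> 0\<close> y(2) by (simp_all add: blinfun.scaleR_left)
      ultimately show ?thesis
        using ex1 sh y(1) by metis
    qed
    have "(1 / norm f) * f (T x0) = (s *\<^sub>R h) (T (s *\<^sub>R v))"
      by (simp add: sv sh blinfun.scaleR_left)
    also have "\<dots> = s * s * h (T v)"
      by (simp add: blinfun.scaleR_left blinfun.scaleR_right)
    finally have "f (T x0) \<le> 0"
      using hTv s(1) \<open>f \<noteq> 0\<close> by (simp add: field_simps mult_nonneg_nonpos)
    then have "f (T x) \<le> 0"
      by (subst x0(2)) (simp add: blinfun.scaleR_right mult_nonneg_nonpos)
    with \<open>f (T x) > 0\<close> show False
      by simp
  qed
  ultimately show ?thesis
    by blast
qed

section \<open>Ball coverings of compact sets\<close>

text \<open>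
  The balls \<open>B(N z\<^sub>i, N)\<close> increase with \<open>N\<close>, hence so do their unions over \<open>i\<close>, and one
  union in this chain of open sets already contains the compact set.
\<close>

lemma has_ball_covering_of_directions:
  fixes z :: "'i \<Rightarrow> 'a::real_normed_vector"
  assumes "compact A" "finite I" and unit: "\<And>i. i \<in> I \<Longrightarrow> norm (z i) = 1"
    and cover: "\<And>a. a \<in> A \<Longrightarrow> \<exists>i\<in>I. \<exists>t>0. norm (t *\<^sub>R z i - a) < t"
  shows "has_ball_covering A (card I)"
proof -
  have mono: "norm (t' *\<^sub>R z i - a) < t'" if "i \<in> I" "norm (t *\<^sub>R z i - a) < t" "t \<le> t'" for i t t' a
  proof -
    have "norm ((t *\<^sub>R z i - a) + (t' - t) *\<^sub>R z i) \<le> norm (t *\<^sub>R z i - a) + (t' - t)"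
      using norm_triangle_ineq[of "t *\<^sub>R z i - a" "(t' - t) *\<^sub>R z i"] unit that by simp
    moreover have "(t *\<^sub>R z i - a) + (t' - t) *\<^sub>R z i = t' *\<^sub>R z i - a"
      by (simp add: algebra_simps)
    ultimately show ?thesis
      using that(2) by simp
  qed
  define U where "U N = (\<Union>i\<in>I. ball (real N *\<^sub>R z i) (real N))" for N :: nat
  have "A \<subseteq> (\<Union>N\<in>UNIV. U N)"
  proof
    fix a assume "a \<in> A"
    then obtain i t where i: "i \<in> I" and t: "norm (t *\<^sub>R z i - a) < t"
      using cover by blast
    obtain N where "t \<le> real N"
      using real_arch_simple by blast
    then have "a \<in> ball (real N *\<^sub>R z i) (real N)"
      using mono[OF i t] by (simp add: dist_norm)
    then show "a \<in> (\<Union>N\<in>UNIV. U N)"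
      using i by (auto simp: U_def)
  qed
  moreover have "open (U N)" for N
    by (auto simp: U_def)
  ultimately obtain F where F: "finite F" "A \<subseteq> (\<Union>N\<in>F. U N)"
    using compactE_image[OF \<open>compact A\<close>, of UNIV U] by auto
  define N where "N = Suc (Max (insert 0 F))"
  have "U k \<subseteq> U N" if "k \<in> F" for k
  proof -
    have "k \<le> N"
      using that F(1) by (simp add: N_def le_SucI)
    then show ?thesis
      using mono[where t = "real k" and t' = "real N"] unfolding U_def
      by (intro UN_mono subsetI) (auto simp: dist_norm)
  qed
  then have A: "A \<subseteq> U N"
    using F(2) by blast
  obtain e where e: "bij_betw e {0..<card I} I"
    using ex_bij_betw_nat_finite[OF \<open>finite I\<close>] by blast
  then have e_image: "e ` {..<card I} = I"
    by (simp add: bij_betw_def atLeast0LessThan)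
  have "real N > 0"
    by (simp add: N_def)
  show ?thesis
    unfolding has_ball_covering_def
  proof (intro exI conjI allI impI)
    fix i assume "i < card I"
    then have "norm (z (e i)) = 1"
      using e_image unit by blast
    then show "real N *\<^sub>R z (e i) \<noteq> 0" "real N > 0" "real N \<le> norm (real N *\<^sub>R z (e i))"
      using \<open>real N > 0\<close> by auto
  next
    have "U N = (\<Union>i\<in>e ` {..<card I}. ball (real N *\<^sub>R z i) (real N))"
      by (simp add: U_def e_image)
    with A show "A \<subseteq> (\<Union>i<card I. ball (real N *\<^sub>R z (e i)) (real N))"
      by (simp add: image_image)
  qed
qed

section \<open>The covering by \<open>mn + 1\<close> balls\<close>

theorem theorem1p5:
  fixes m n :: nat
  assumes "m \<ge> 1" and "n \<ge> 1"
    and "dim (UNIV :: 'a::banach set) = m"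
    and "strictly_convex_space TYPE('a)"
    and "dim (UNIV :: 'b::banach set) = n"
    and "smooth_space TYPE('b)"
  shows "has_ball_covering (sphere (0 :: 'a \<Rightarrow>\<^sub>L 'b) 1) (m * n + 1)"
proof -
  obtain B :: "'a set" where B: "finite_basis B" "card B = m"
    using dim_pos_finite_basis assms(1,3) by blast
  obtain C :: "'b set" where C: "finite_basis C" "card C = n"
    using dim_pos_finite_basis assms(2,5) by blast
  interpret B: finite_basis B by (rule B(1))
  interpret C: finite_basis C by (rule C(1))
  obtain D :: "('a \<Rightarrow>\<^sub>L 'b) set" where "finite_basis D"
    using finite_basis_blinfun[OF B(1) C(1)] by blast
  then interpret D: finite_basis D .
  define I where "I = insert None (Some ` (B \<times> C))"
  have finite_I: "finite I"
    using B.finite_B C.finite_B by (simp add: I_def)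
  have "card I = m * n + 1"
    unfolding I_def using B C B.finite_B C.finite_B
    by (subst card_insert_disjoint) (auto simp: card_image card_cartesian_product)
  define P :: "('a \<times> 'b) option \<Rightarrow> 'a \<times> ('b \<Rightarrow>\<^sub>L real)" where
    "P i = (case i of None \<Rightarrow> (- (\<Sum>b\<in>B. b), \<Sum>c\<in>C. C.coord c) | Some (b, c) \<Rightarrow> (b, C.coord c))" for i
  have P_nonzero: "fst (P i) \<noteq> 0 \<and> snd (P i) \<noteq> 0" if "i \<in> I" for i
  proof (cases i)
    case None
    obtain b c where bc: "b \<in> B" "c \<in> C"
      using B(2) C(2) assms(1,2) by fastforce
    have "B.coord b (\<Sum>b\<in>B. b) = 1"
      using bc B.finite_B by (simp add: blinfun.sum_right B.coord_basis)
    moreover have "(\<Sum>c\<in>C. C.coord c) c = 1"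
      using bc C.finite_B by (simp add: blinfun.sum_left C.coord_basis)
    ultimately show ?thesis
      using None by (auto simp: P_def blinfun.zero_right)
  next
    case (Some p)
    obtain b c where bc: "p = (b, c)" "b \<in> B" "c \<in> C"
      using Some \<open>i \<in> I\<close> by (auto simp: I_def)
    have "B.coord b b = 1" "C.coord c c = 1"
      using bc by (simp_all add: B.coord_basis C.coord_basis)
    then show ?thesis
      using Some bc(1) by (auto simp: P_def blinfun.zero_right)
  qed
  have "\<exists>z::'a \<Rightarrow>\<^sub>L 'b. norm z = 1 \<and>
      (\<forall>T. snd (P i) (blinfun_apply T (fst (P i))) > 0 \<longrightarrow> (\<exists>t>0. norm (t *\<^sub>R z - T) < t))" if "i \<in> I" for i
    using rank_one_direction[OF B(1) C(1) assms(4,6)] P_nonzero[OF that] by blast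
  then obtain z where z: "\<And>i. i \<in> I \<Longrightarrow> norm (z i) = 1"
    "\<And>i T. i \<in> I \<Longrightarrow> blinfun_apply (snd (P i)) (blinfun_apply T (fst (P i))) > 0 \<Longrightarrow>
      \<exists>t>0. norm (t *\<^sub>R z i - (T :: 'a \<Rightarrow>\<^sub>L 'b)) < t"
    by metis
  \<comment> \<open>If no functional is positive at \<open>T\<close>, then the entries of the matrix of \<open>T\<close> are nonpositive while
    their sum is nonnegative.\<close>
  have "\<exists>i\<in>I. snd (P i) (T (fst (P i))) > 0" if "T \<in> sphere 0 1" for T :: "'a \<Rightarrow>\<^sub>L 'b"
  proof (rule ccontr)
    assume "\<not> (\<exists>i\<in>I. snd (P i) (T (fst (P i))) > 0)"
    then have nonpos: "snd (P i) (T (fst (P i))) \<le> 0" if "i \<in> I" for i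
      using that by (meson not_le)
    have le0: "C.coord c (T b) \<le> 0" if "b \<in> B" "c \<in> C" for b c
      using nonpos[of "Some (b, c)"] that by (simp add: I_def P_def)
    have "0 \<le> (\<Sum>b\<in>B. \<Sum>c\<in>C. C.coord c (T b))"
      using nonpos[of None]
      by (simp add: I_def P_def blinfun.minus_right blinfun.sum_left blinfun.sum_right)
    then have "0 \<le> (\<Sum>(b, c)\<in>B \<times> C. C.coord c (T b))"
      by (simp add: sum.cartesian_product)
    then have "(\<Sum>(b, c)\<in>B \<times> C. - C.coord c (T b)) \<le> 0"
      by (simp add: split_def sum_negf)
    moreover have "(\<Sum>(b, c)\<in>B \<times> C. - C.coord c (T b)) \<ge> 0"
      using le0 by (intro sum_nonneg) auto
    ultimately have "(\<Sum>(b, c)\<in>B \<times> C. - C.coord c (T b)) = 0"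
      by simp
    then have coord0: "C.coord c (T b) = 0" if "b \<in> B" "c \<in> C" for b c
      using that le0 B.finite_B C.finite_B by (subst (asm) sum_nonneg_eq_0_iff) auto
    have T_basis: "T b = 0" if "b \<in> B" for b
      by (subst C.sum_coord[symmetric, of "T b"]) (simp add: coord0 that)
    have "T x = 0" for x
    proof -
      have "T x = (\<Sum>b\<in>B. B.coord b x *\<^sub>R T b)"
        by (subst B.sum_coord[symmetric, of x]) (simp only: blinfun.sum_right blinfun.scaleR_right)
      also have "\<dots> = 0"
        by (simp add: T_basis)
      finally show ?thesis .
    qed
    then have "T = 0"
      by (intro blinfun_eqI) simp
    then show False
      using that by simp
  qed
  then have "has_ball_covering (sphere (0 :: 'a \<Rightarrow>\<^sub>L 'b) 1) (card I)"
    using z by (intro has_ball_covering_of_directions[OF D.compact_sphere finite_I, of z]) blast+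
  then show ?thesis
    by (simp add: \<open>card I = m * n + 1\<close>)
qed

end
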